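(* Let $\mathbb F$ be a field and let $d\geq 1$ be an integer. Let $A, A^*$ denote a circular bidiagonal pair on a vector space over $\mathbb F$ of dimension $d+1$. First assume that ${\rm Char}(\mathbb F)\neq d+1$. Then $A,A^*$ is affine equivalent to ${\rm CBP}(\mathbb F;d,q,\varepsilon)$ for at least one ordered pair $q,\varepsilon$, where $q\in\mathbb F$ is a primitive $(d+1)^{\rm th}$ root of unity and $\varepsilon\in\mathbb F$ is not among $1,q,q^2,\ldots,q^d$. Next assume that ${\rm Char}(\mathbb F)=d+1$. Then $A,A^*$ is affine equivalent to ${\rm CBP}(\mathbb F;d,\gamma)$ for at least one $\gamma\in\mathbb F$ that is not among $0,1,2,\ldots,d$.
   Context: Matrices in ${\rm Mat}_{d+1}(\mathbb F)$ have rows and columns indexed by $0,1,\ldots,d$. For a basis $\{v_i\}_{i=0}^d$ of $V$, a matrix $X$ represents $A\in{\rm End}(V)$ whenever $Av_j=\sum_i X_{i,j}v_i$ for all $j$. For $d\ge 1$, a matrix in ${\rm Mat}_{d+1}(\mathbb F)$ is circular bidiagonal whenever (i) each nonzero entry is on the diagonal, or the subdiagonal (entries $(i,i-1)$, $1\le i\le d$), or in the top-right corner (entry $(0,d)$); (ii) each subdiagonal entry is nonzero and the top-right corner entry is nonzero. A circular bidiagonal pair on a $(d+1)$-dimensional vector space $V$ over $\mathbb F$ is an ordered pair of $\mathbb F$-linear maps $A:V\to V$, $A^*:V\to V$ such that (i) there exists a basis for $V$ with respect to which the matrix representing $A$ is circular bidiagonal and the matrix representing $A^*$ is diagonal; (ii)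 there exists a basis for $V$ with respect to which the matrix representing $A^*$ is circular bidiagonal and the matrix representing $A$ is diagonal. (Here $A^*$ is just a name for a second map.) Isomorphism: circular bidiagonal pairs $A,A^*$ on $V$ and $B,B^*$ on $\mathcal V$ are isomorphic whenever there exists a vector space isomorphism $\sigma:V\to\mathcal V$ with $\sigma A=B\sigma$ and $\sigma A^*=B^*\sigma$. Affine transformation: for $s,s^*,t,t^*\in\mathbb F$ with $s,s^*$ nonzero, the circular bidiagonal pair $sA+tI,\ s^*A^*+t^*I$ is called an affine transformation of $A,A^*$. Two circular bidiagonal pairs are affine equivalent whenever some affine transformation of the first is isomorphic to the second. ${\rm CBP}(\mathbb F;d,q,\varepsilon)$: here $q\in\mathbb F$ is a primitive $(d+1)^{\rm th}$ root of unity and $\varepsilon\in\mathbb F$ is not among $1,q,\ldots,q^d$. It is the circular bidiagonal pair $A,A^*$ on $\mathbb F^{d+1}$ (column vectors, action by left multiplication) where $A_{i,i}=q^{-i}\varepsilon$ $(0\le i\le d)$, $A_{0,d}=1-\varepsilon$, $A_{i,i-1}=1-q^{-i}\varepsilon$ $(1\le i\le d)$, all other entries of $A$ are zero, and $A^*={\rm diag}(1,q,q^2,\ldots,q^d)$. ${\rm CBP}(\mathbb F;d,\gamma)$: here $d+1$ is prime, ${\rm Char}(\mathbb F)=d+1$, and $\gamma\in\mathbb F$ is not among $0,1,\ldots,d$. It is the circular bidiagonal pair $A,A^*$ on $\mathbb F^{d+1}$ where $A_{i,i}=i+\gamma$ $(0\le i\le d)$, $A_{0,d}=-\gamma$, $A_{i,i-1}=-i-\gamma$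 $(1\le i\le d)$, all other entries of $A$ are zero, and $A^*={\rm diag}(0,1,2,\ldots,d)$. *)

theory Defs
  imports Jordan_Normal_Form.VS_Connect "HOL-Computational_Algebra.Primes"
begin

definition circular_bidiagonal_mat :: "nat \<Rightarrow> 'f::field mat \<Rightarrow> bool" where
  "circular_bidiagonal_mat d X \<longleftrightarrow>
     X \<in> carrier_mat (d + 1) (d + 1) \<and>
     (\<forall>i\<le>d. \<forall>j\<le>d. X $$ (i, j) \<noteq> 0 \<longrightarrow> i = j \<or> i = j + 1 \<or> (i = 0 \<and> j = d)) \<and>
     (\<forall>i\<in>{1..d}. X $$ (i, i - 1) \<noteq> 0) \<and>
     X $$ (0, d) \<noteq> 0"

definition ordered_basis :: "nat \<Rightarrow> ('f::field, 'v) module \<Rightarrow> (nat \<Rightarrow> 'v) \<Rightarrow> bool" where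
  "ordered_basis d V v \<longleftrightarrow> inj_on v {0..d} \<and> vectorspace.basis class_ring V (v ` {0..d})"

definition represents ::
  "nat \<Rightarrow> ('f::field, 'v) module \<Rightarrow> (nat \<Rightarrow> 'v) \<Rightarrow> 'f mat \<Rightarrow> ('v \<Rightarrow> 'v) \<Rightarrow> bool" where
  "represents d V v X A \<longleftrightarrow>
     X \<in> carrier_mat (d + 1) (d + 1) \<and>
     (\<forall>j\<le>d. A (v j) = (\<Oplus>\<^bsub>V\<^esub>i\<in>{0..d}. X $$ (i, j) \<odot>\<^bsub>V\<^esub> v i))"

text \<open>
  The finiteness condition is stated separately because \<open>vectorspace.dim\<close> is a
  \<open>LEAST\<close> and hence unspecified for spaces that are not finite-dimensional.
\<close>

definition circular_bidiagonal_pair ::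
  "nat \<Rightarrow> ('f::field, 'v) module \<Rightarrow> ('v \<Rightarrow> 'v) \<Rightarrow> ('v \<Rightarrow> 'v) \<Rightarrow> bool" where
  "circular_bidiagonal_pair d V A A' \<longleftrightarrow>
     vectorspace class_ring V \<and>
     vectorspace.fin_dim class_ring V \<and>
     vectorspace.dim class_ring V = d + 1 \<and>
     linear_map class_ring V V A \<and>
     linear_map class_ring V V A' \<and>
     (\<exists>v X D. ordered_basis d V v \<and>
        represents d V v X A \<and> circular_bidiagonal_mat d X \<and>
        represents d V v D A' \<and> diagonal_mat D) \<and>
     (\<exists>v X D. ordered_basis d V v \<and>
        represents d V v X A' \<and> circular_bidiagonal_mat d X \<and>
        represents d V v D A \<and> diagonal_mat D)"

definition isomorphic_pairs ::
  "('f::field, 'v) module \<Rightarrow> ('v \<Rightarrow> 'v) \<Rightarrow> ('v \<Rightarrow> 'v) \<Rightarrow>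
   ('f, 'w) module \<Rightarrow> ('w \<Rightarrow> 'w) \<Rightarrow> ('w \<Rightarrow> 'w) \<Rightarrow> bool" where
  "isomorphic_pairs V A A' W B B' \<longleftrightarrow>
     (\<exists>\<sigma>. linear_map class_ring V W \<sigma> \<and> bij_betw \<sigma> (carrier V) (carrier W) \<and>
        (\<forall>x\<in>carrier V. \<sigma> (A x) = B (\<sigma> x)) \<and>
        (\<forall>x\<in>carrier V. \<sigma> (A' x) = B' (\<sigma> x)))"

definition affine_map :: "('f::field, 'v) module \<Rightarrow> 'f \<Rightarrow> 'f \<Rightarrow> ('v \<Rightarrow> 'v) \<Rightarrow> 'v \<Rightarrow> 'v" where
  "affine_map V s t A = (\<lambda>x. s \<odot>\<^bsub>V\<^esub> A x \<oplus>\<^bsub>V\<^esub> t \<odot>\<^bsub>V\<^esub> x)"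

definition affine_equivalent ::
  "('f::field, 'v) module \<Rightarrow> ('v \<Rightarrow> 'v) \<Rightarrow> ('v \<Rightarrow> 'v) \<Rightarrow>
   ('f, 'w) module \<Rightarrow> ('w \<Rightarrow> 'w) \<Rightarrow> ('w \<Rightarrow> 'w) \<Rightarrow> bool" where
  "affine_equivalent V A A' W B B' \<longleftrightarrow>
     (\<exists>s t s' t'. s \<noteq> 0 \<and> s' \<noteq> 0 \<and>
        isomorphic_pairs V (affine_map V s t A) (affine_map V s' t' A') W B B')"

definition primitive_root_of_unity :: "nat \<Rightarrow> 'f::field \<Rightarrow> bool" where
  "primitive_root_of_unity n q \<longleftrightarrow> q ^ n = 1 \<and> (\<forall>k. 0 < k \<and> k < n \<longrightarrow> q ^ k \<noteq> 1)"

text \<open>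
  The maps of the pairs \<open>CBP(F; d, q, \<epsilon>)\<close> and \<open>CBP(F; d, \<gamma>)\<close> are left multiplication by
  the following matrices on the space \<open>module_vec TYPE('f) (d + 1)\<close> of column vectors.
\<close>

definition CBP_q_mat :: "nat \<Rightarrow> 'f::field \<Rightarrow> 'f \<Rightarrow> 'f mat" where
  "CBP_q_mat d q \<epsilon> = mat (d + 1) (d + 1) (\<lambda>(i, j).
     if i = j then inverse (q ^ i) * \<epsilon>
     else if i = 0 \<and> j = d then 1 - \<epsilon>
     else if i = j + 1 then 1 - inverse (q ^ i) * \<epsilon>
     else 0)"

definition CBP_q_dual_mat :: "nat \<Rightarrow> 'f::field \<Rightarrow> 'f mat" where
  "CBP_q_dual_mat d q = mat_diag (d + 1) (\<lambda>i. q ^ i)"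

definition CBP_char_mat :: "nat \<Rightarrow> 'f::field \<Rightarrow> 'f mat" where
  "CBP_char_mat d \<gamma> = mat (d + 1) (d + 1) (\<lambda>(i, j).
     if i = j then of_nat i + \<gamma>
     else if i = 0 \<and> j = d then - \<gamma>
     else if i = j + 1 then - of_nat i - \<gamma>
     else 0)"

definition CBP_char_dual_mat :: "nat \<Rightarrow> 'f::field mat" where
  "CBP_char_dual_mat d = mat_diag (d + 1) of_nat"

end

theory Submission
  imports Defs
begin

text \<open>
  Let \<open>v\<close> and \<open>w\<close> be the two bases from the definition of a circular bidiagonal pair, with
  indices modulo \<open>d + 1\<close>, and let \<open>P i j\<close> be the \<open>v i\<close>-coordinate of \<open>w j\<close>. The map that is
  diagonal on \<open>v\<close> and bidiagonal on \<open>w\<close> relates neighbouring entries in a row of \<open>P\<close>, the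
  other map relates neighbouring entries in a column. Since \<open>P\<close> is invertible, it has no zero
  entry and both maps have distinct eigenvalues; comparing the two paths between diagonally
  adjacent entries then forces the eigenvalues \<open>ts i\<close>, \<open>th j\<close> and the diagonal entries \<open>a i\<close> to
  satisfy first-order affine recurrences with the same ratio \<open>s\<close>. If \<open>s = 1\<close> they are arithmetic
  progressions modulo \<open>d + 1\<close>, hence the characteristic is \<open>d + 1\<close>; otherwise \<open>s\<close> is a primitive
  root of unity. Finally \<open>P i 0\<close> is the scaling of \<open>v i\<close> that brings the off-diagonal entries
  into the prescribed form.
\<close>

section \<open>Cyclic two-term relations and the recurrences they force\<close>

lemma power_prime_CHAR_eq_1D:
  fixes s :: "'f::field"
  assumes "prime CHAR('f)" "s ^ CHAR('f) = 1"
  shows "s = 1"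
proof -
  let ?p = "CHAR('f)"
  \<comment> \<open>Writing \<open>s\<close> as \<open>(s - 1) + 1\<close> makes the Frobenius map
    show that \<open>s - 1\<close> is nilpotent.\<close>
  have "((s - 1) + 1) ^ ?p = (s - 1) ^ ?p + 1 ^ ?p"
    using assms(1) by (rule freshmans_dream) simp
  hence "(s - 1) ^ ?p = 0" using assms(2) by simp
  thus ?thesis by simp
qed

lemma Suc_mod_neq: "2 \<le> n \<Longrightarrow> Suc j mod n \<noteq> j mod n"
  by (simp add: mod_Suc)

text \<open>Indices range over all naturals and are read modulo \<open>n\<close>, so the corner
  entry needs no separate case. Of the invertibility of \<open>P\<close> only \<open>rows\<close>
  and \<open>cols\<close> are kept; \<open>rows\<close> with \<open>l = 0\<close> also excludes a
  zero row.\<close>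

locale bidiagonal_intertwiner =
  fixes n :: nat and ts th a b x y :: "nat \<Rightarrow> 'f::field" and P :: "nat \<Rightarrow> nat \<Rightarrow> 'f"
  assumes n: "2 \<le> n"
    and x_nz: "x i \<noteq> 0" and y_nz: "y j \<noteq> 0"
    and row_step: "(ts i - b j) * P i j = y j * P i (Suc j)"
    and col_step: "(th j - a (Suc i)) * P (Suc i) j = x i * P i j"
    and P_col_mod: "P i (j mod n) = P i j"
    and th_mod: "th (j mod n) = th j"
    and a_mod: "a (i mod n) = a i"
    and rows: "(\<And>j. P i j = l * P k j) \<Longrightarrow> i mod n = k mod n"
    and cols: "(\<And>i. P i j = l * P i k) \<Longrightarrow> j mod n = k mod n"
begin

text \<open>As \<open>y\<close> never vanishes, \<open>row_step\<close> carries a zero to the next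
  column and so around the whole cycle, leaving a zero row.\<close>

lemma P_nz: "P i j \<noteq> 0"
proof
  assume 0: "P i j = 0"
  have shift: "P i (j + m) = 0" for m
  proof (induction m)
    case (Suc m)
    thus ?case using row_step[of i "j + m"] y_nz[of "j + m"] by simp
  qed (use 0 in simp)
  have "P i k = 0" for k
  proof -
    have "j \<le> k + n * j" using n by (simp add: trans_le_add2)
    \<comment> \<open>Zeros only move to the right, so column \<open>k\<close> is reached through a
      later representative of its class modulo \<open>n\<close>.\<close>
    hence "P i (k + n * j) = 0" using shift[of "k + n * j - j"] by simp
    thus ?thesis using P_col_mod[of i "k + n * j"] P_col_mod[of i k] by simp
  qed
  hence "i mod n = Suc i mod n" by (intro rows[of _ 0]) simp
  thus False using Suc_mod_neq[OF n, of i] by simp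
qed

text \<open>By \<open>row_step\<close>, a row of \<open>P\<close> is determined by its first entry
  and its eigenvalue \<open>ts i\<close>, so equal eigenvalues give proportional rows.\<close>

lemma ts_eqD:
  assumes "ts i = ts k"
  shows "i mod n = k mod n"
proof (rule rows)
  define l where "l = P i 0 / P k 0"
  show "P i j = l * P k j" for j
  proof (induction j)
    case (Suc j)
    have "y j * P i (Suc j) = y j * (l * P k (Suc j))"
      using Suc assms row_step[of i j] row_step[of k j] by (metis mult.left_commute)
    thus ?case using y_nz[of j] by simp
  qed (simp add: l_def P_nz)
qed

text \<open>The column analogue of \<open>ts_eqD\<close>. Passing from row \<open>i\<close> to row
  \<open>Suc i\<close> divides by \<open>th k - a (Suc i)\<close>, which is nonzero because the
  right-hand side of \<open>col_step\<close> is.\<close>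

lemma th_eqD:
  assumes "th j = th k"
  shows "j mod n = k mod n"
proof (rule cols)
  have step: "P (Suc i) j = l * P (Suc i) k \<longleftrightarrow> P i j = l * P i k" for i l
  proof -
    have 1: "x i * (P i j - l * P i k) = (th k - a (Suc i)) * (P (Suc i) j - l * P (Suc i) k)"
      using col_step[of j i] col_step[of k i] assms by (simp add: algebra_simps)
    moreover have "th k - a (Suc i) \<noteq> 0"
      using col_step[of k i] x_nz[of i] P_nz[of i k] by auto
    ultimately show ?thesis using x_nz[of i]
      by (metis eq_iff_diff_eq_0 mult_eq_0_iff)
  qed
  define l where "l = P 0 j / P 0 k"
  have "P 0 j = l * P 0 k" by (simp add: l_def P_nz)
  thus "P i j = l * P i k" for i by (induction i) (simp_all add: step)
qed

lemma th_neq_a: "th j \<noteq> a i"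
proof -
  have "th j \<noteq> a (Suc k)" for k
    using col_step[of j k] x_nz[of k] P_nz[of k j] by auto
  \<comment> \<open>Going once around the cycle makes every index, including 0, a successor.\<close>
  from this[of "i + n - 1"] show ?thesis
    using n a_mod[of i] a_mod[of "i + n"] by simp
qed

text \<open>Two ways of moving from the entry \<open>(i + 1, j)\<close> of \<open>P\<close> to the entry \<open>(i, j + 1)\<close>.\<close>

lemma exchange:
  "(ts (Suc i) - b j) * (th (Suc j) - a (Suc i)) = (th j - a (Suc i)) * (ts i - b j)"
proof -
  have "x i * y j * P i (Suc j) = y j * ((th (Suc j) - a (Suc i)) * P (Suc i) (Suc j))"
    by (simp add: col_step)
  also have "\<dots> = (th (Suc j) - a (Suc i)) * ((ts (Suc i) - b j) * P (Suc i) j)"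
    by (simp add: row_step)
  finally have 1: "x i * y j * P i (Suc j) =
      ((ts (Suc i) - b j) * (th (Suc j) - a (Suc i))) * P (Suc i) j"
    by (simp add: ac_simps)
  have "x i * y j * P i (Suc j) = (ts i - b j) * (x i * P i j)"
    using row_step[of i j] by (simp add: ac_simps)
  also have "\<dots> = ((th j - a (Suc i)) * (ts i - b j)) * P (Suc i) j"
    by (simp add: col_step[symmetric])
  finally show ?thesis using 1 P_nz[of "Suc i" j] by simp
qed

text \<open>For each \<open>j\<close>, differencing \<open>exchange\<close> in \<open>j\<close>
  yields an affine relation between \<open>ts i\<close> and \<open>ts (Suc i)\<close>. Its slope
  \<open>S j\<close> is the ratio of consecutive differences of \<open>th\<close>, so once the slope
  is known to be constant, both \<open>ts\<close> and \<open>th\<close> satisfy recurrences with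
  ratio \<open>s\<close>.\<close>

lemma affine_recurrence:
  obtains s r t where "s \<noteq> 0"
    "\<And>i. ts i = s * ts (Suc i) + r"
    "\<And>j. th (Suc j) = s * th j + t"
    "\<And>i. a (Suc i) = s * a i + t"
proof -
  define D where "D j = th (Suc j) - th j" for j
  have D_nz: "D j \<noteq> 0" for j
    using th_eqD[of "Suc j" j] Suc_mod_neq[OF n, of j] by (auto simp: D_def)
  define S where "S j = D (Suc j) / D j" for j
  define R where "R j = b j - S j * b (Suc j)" for j
  have rec: "ts i = S j * ts (Suc i) + R j" for i j
  proof -
    \<comment> \<open>In the difference of two consecutive instances of \<open>exchange\<close>, the products
      of \<open>a (Suc i)\<close> with \<open>ts\<close> cancel.\<close>
    have "D j * ts i = D (Suc j) * ts (Suc i) + D j * b j - D (Suc j) * b (Suc j)"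
      using arg_cong2[where f = "(-)", OF exchange[of i "Suc j"] exchange[of i j]]
      by (simp add: D_def algebra_simps)
    also have "\<dots> = D j * (S j * ts (Suc i) + R j)"
      using D_nz[of j] by (simp add: S_def R_def algebra_simps)
    finally show ?thesis using D_nz[of j] by simp
  qed
  \<comment> \<open>An affine function is determined by its values at the two distinct points
    \<open>ts 1\<close> and \<open>ts 2\<close>.\<close>
  have S_const: "S j = S 0" for j
  proof -
    have "S j * ts 1 + R j = S 0 * ts 1 + R 0" "S j * ts 2 + R j = S 0 * ts 2 + R 0"
      using rec[of 0 j] rec[of 0 0] rec[of 1 j] rec[of 1 0] by (simp_all add: numeral_2_eq_2)
    from arg_cong2[where f = "(-)", OF this] have "(S j - S 0) * (ts 1 - ts 2) = 0"
      by (simp add: algebra_simps)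
    moreover have "ts 1 \<noteq> ts 2"
      using ts_eqD[of 1 2] Suc_mod_neq[OF n, of 1] by (auto simp: numeral_2_eq_2)
    ultimately show ?thesis by simp
  qed
  define s r t where "s = S 0" and "r = R 0" and "t = th 1 - s * th 0"
  have s: "s \<noteq> 0" using D_nz by (simp add: s_def S_def)
  have ts_rec: "ts i = s * ts (Suc i) + r" for i
    using rec[of i 0] by (simp add: s_def r_def)
  have D_rec: "D (Suc j) = s * D j" for j
    using S_const[of j] D_nz[of j] by (simp add: S_def s_def field_simps)
  have th_rec: "th (Suc j) = s * th j + t" for j
  proof (induction j)
    case (Suc j)
    thus ?case using D_rec[of j] by (simp add: D_def algebra_simps)
  qed (simp add: t_def)
  define E where "E i = ts i - ts (Suc i)" for i
  have E_nz: "E i \<noteq> 0" for i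
    using ts_eqD[of i "Suc i"] Suc_mod_neq[OF n, of i] by (auto simp: E_def)
  \<comment> \<open>This is the part independent of \<open>i\<close> when \<open>exchange\<close>
    with \<open>j = 0\<close> is solved for \<open>a (Suc i) * E i\<close>.\<close>
  define K where "K = b 0 * (th 1 - th 0) + r * th 0"
  have aE: "a (Suc i) * E i = K - t * ts (Suc i)" for i
    using exchange[of i 0] ts_rec[of i] th_rec[of 0] by (simp add: E_def K_def algebra_simps)
  have a_rec: "a (Suc (Suc i)) = s * a (Suc i) + t" for i
  proof -
    have "E i = s * E (Suc i)"
      using ts_rec[of i] ts_rec[of "Suc i"] by (simp add: E_def algebra_simps)
    hence "(s * a (Suc i) + t) * E (Suc i) = a (Suc i) * E i + t * E (Suc i)"
      by (simp add: algebra_simps)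
    also have "\<dots> = a (Suc (Suc i)) * E (Suc i)"
      by (simp add: aE) (simp add: E_def algebra_simps)
    finally show ?thesis using E_nz[of "Suc i"] by simp
  qed
  \<comment> \<open>So far the recurrence for \<open>a\<close> starts only at index 1; periodicity
    supplies index 0.\<close>
  have "a (Suc i) = s * a i + t" for i
  proof -
    have period: "a (k + n) = a k" for k using a_mod[of "k + n"] a_mod[of k] by simp
    show ?thesis using a_rec[of "i + n - 1"] n period[of i] period[of "Suc i"] by simp
  qed
  with that s ts_rec th_rec show thesis by blast
qed

section \<open>Solving the recurrences: arithmetic and geometric progressions\<close>

lemma th_n: "th n = th 0"
  using th_mod[of n] by simp

text \<open>With ratio 1 all three sequences are arithmetic progressions. Periodicity of
  \<open>th\<close> makes \<open>n\<close> vanish in the field, and distinctness modulo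
  \<open>n\<close> rules out a smaller characteristic.\<close>

lemma CHAR_case:
  assumes ts_rec: "\<And>i. ts i = ts (Suc i) + r" and th_rec: "\<And>j. th (Suc j) = th j + t"
    and a_rec: "\<And>i. a (Suc i) = a i + t"
  obtains u w u' w' \<gamma> where "CHAR('f) = n" "u \<noteq> 0" "u' \<noteq> 0"
    "\<gamma> \<notin> of_nat ` {..<n}" "\<And>i. u * a i + w = of_nat i + \<gamma>" "u * th 0 + w = 0"
    "\<And>i. u' * ts i + w' = of_nat i"
proof -
  have th: "th j = th 0 + of_nat j * t" for j
    by (induction j) (simp_all add: th_rec algebra_simps)
  have ts: "ts i = ts 0 - of_nat i * r" for i
  proof (induction i)
    case (Suc i)
    have "ts (Suc i) = ts i - r" by (simp only: ts_rec[of i] add_diff_cancel_right')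
    thus ?case using Suc by (simp add: algebra_simps)
  qed simp
  have a: "a i = a 0 + of_nat i * t" for i
    by (induction i) (simp_all add: a_rec algebra_simps)
  have t: "t \<noteq> 0" using th_eqD[of 1 0] Suc_mod_neq[OF n, of 0] th[of 1] by auto
  have r: "r \<noteq> 0" using ts_eqD[of 1 0] Suc_mod_neq[OF n, of 0] ts[of 1] by auto
  have "of_nat n = (0 :: 'f)" using th[of n] th_n t by simp
  hence dvd: "CHAR('f) dvd n" by (simp add: of_nat_eq_0_iff_char_dvd)
  \<comment> \<open>This also excludes characteristic 0, since 0 does not divide
    \<open>n\<close>.\<close>
  have "\<not> CHAR('f) < n"
  proof
    assume less: "CHAR('f) < n"
    hence "CHAR('f) mod n = 0 mod n" using th[of "CHAR('f)"] by (intro th_eqD) simp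
    with less dvd n show False by simp
  qed
  with dvd n have char: "CHAR('f) = n" by (metis dvd_imp_le less_le_trans linorder_neqE_nat not_less pos2)
  \<comment> \<open>The first affine change sends \<open>th j\<close> to \<open>j\<close>, the
    second sends \<open>ts i\<close> to \<open>i\<close>; \<open>\<gamma>\<close> is the image of
    \<open>a 0\<close>. If it were some \<open>i < n\<close>, then \<open>a 0\<close> would equal
    \<open>th i\<close>.\<close>
  show thesis
  proof (rule that[of "1 / t" "- 1 / r" "(a 0 - th 0) / t" "- th 0 / t" "ts 0 / r"])
    show "(a 0 - th 0) / t \<notin> of_nat ` {..<n}"
    proof
      assume "(a 0 - th 0) / t \<in> of_nat ` {..<n}"
      then obtain i where "(a 0 - th 0) / t = of_nat i" by auto
      hence "a 0 = th i" using t th[of i] by (simp add: field_simps)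
      thus False using th_neq_a[of i 0] by simp
    qed
    show "1 / t * a i + - th 0 / t = of_nat i + (a 0 - th 0) / t" for i
      using t a[of i] by (simp add: field_simps)
    show "- 1 / r * ts i + ts 0 / r = of_nat i" for i
      using r ts[of i] by (simp add: field_simps)
  qed (use char t r in auto)
qed

text \<open>Centred at the fixed points of the recurrences, the sequences become geometric.
  Periodicity and distinctness of \<open>th\<close> then give \<open>s\<close> the exact order
  \<open>n\<close>.\<close>

lemma root_of_unity_case:
  assumes s: "s \<noteq> 0" "s \<noteq> 1"
    and ts_rec: "\<And>i. ts i = s * ts (Suc i) + r" and th_rec: "\<And>j. th (Suc j) = s * th j + t"
    and a_rec: "\<And>i. a (Suc i) = s * a i + t"
  obtains u w u' w' q \<epsilon> where "CHAR('f) \<noteq> n" "u \<noteq> 0" "u' \<noteq> 0"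
    "primitive_root_of_unity n q" "\<epsilon> \<notin> (\<lambda>i. q ^ i) ` {..<n}"
    "\<And>i. u * a i + w = inverse (q ^ i) * \<epsilon>" "u * th 0 + w = 1"
    "\<And>i. u' * ts i + w' = q ^ i"
proof -
  \<comment> \<open>The recurrence for \<open>ts\<close> runs backwards, so \<open>ts\<close> has
    ratio \<open>inverse s\<close> while \<open>th\<close> and \<open>a\<close> have ratio
    \<open>s\<close>.\<close>
  define q where "q = inverse s"
  define c c' where "c = t / (1 - s)" and "c' = r / (1 - s)"
  have c: "c = s * c + t" and c': "c' = s * c' + r"
    using s by (simp_all add: c_def c'_def field_simps)
  have th: "th j - c = s ^ j * (th 0 - c)" for j
  proof (induction j)
    case (Suc j)
    have "th (Suc j) - c = s * (th j - c)" using th_rec[of j] c by (simp add: algebra_simps)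
    thus ?case using Suc by simp
  qed simp
  have a: "a j - c = s ^ j * (a 0 - c)" for j
  proof (induction j)
    case (Suc j)
    have "a (Suc j) - c = s * (a j - c)" using a_rec[of j] c by (simp add: algebra_simps)
    thus ?case using Suc by simp
  qed simp
  have ts: "ts j - c' = q ^ j * (ts 0 - c')" for j
  proof (induction j)
    case (Suc j)
    have "ts j - c' = s * (ts (Suc j) - c')" using ts_rec[of j] c' by (simp add: algebra_simps)
    thus ?case using Suc s by (simp add: q_def field_simps)
  qed simp
  have thc: "th 0 - c \<noteq> 0" using th[of 1] th_eqD[of 1 0] Suc_mod_neq[OF n, of 0] by auto
  have tsc: "ts 0 - c' \<noteq> 0" using ts[of 1] ts_eqD[of 1 0] Suc_mod_neq[OF n, of 0] by auto
  have sn: "s ^ n = 1" using th[of n] th_n thc by simp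
  have prim: "s ^ k \<noteq> 1" if "0 < k" "k < n" for k
    using th[of k] th_eqD[of k 0] that by auto
  show thesis
  proof (rule that[of "1 / (th 0 - c)" "1 / (ts 0 - c')" q "(a 0 - c) / (th 0 - c)"
        "- c / (th 0 - c)" "- c' / (ts 0 - c')"])
    \<comment> \<open>In prime characteristic \<open>n\<close>, the only \<open>n\<close>-th root of
      unity is 1.\<close>
    show "CHAR('f) \<noteq> n"
    proof
      assume "CHAR('f) = n"
      moreover from this have "prime CHAR('f)" using n by (intro prime_CHAR_semidom) simp
      ultimately show False using power_prime_CHAR_eq_1D[of s] sn s by simp
    qed
    show "primitive_root_of_unity n q"
      using sn prim s by (simp add: primitive_root_of_unity_def q_def power_inverse)
    show "(a 0 - c) / (th 0 - c) \<notin> (\<lambda>i. q ^ i) ` {..<n}"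
    proof
      assume "(a 0 - c) / (th 0 - c) \<in> (\<lambda>i. q ^ i) ` {..<n}"
      then obtain i where "(a 0 - c) / (th 0 - c) = q ^ i" by auto
      hence "a i - c = th 0 - c"
        using thc s a[of i] by (simp add: q_def field_simps power_inverse)
      thus False using th_neq_a[of 0 i] by simp
    qed
    show "1 / (th 0 - c) * a i + - c / (th 0 - c) = inverse (q ^ i) * ((a 0 - c) / (th 0 - c))" for i
      using a[of i] by (simp add: q_def power_inverse diff_divide_distrib[symmetric])
    show "1 / (th 0 - c) * th 0 + - c / (th 0 - c) = 1"
      using thc by (simp add: diff_divide_distrib[symmetric])
    show "1 / (ts 0 - c') * ts i + - c' / (ts 0 - c') = q ^ i" for i
      using tsc ts[of i] by (simp add: diff_divide_distrib[symmetric])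
  qed (use thc tsc in auto)
qed

end

section \<open>Coordinates with respect to an indexed basis\<close>

text \<open>Being a basis is recast as two mutually inverse operations, expansion and reading off
  coordinates, so that later sums run over indices rather than over sets of vectors.\<close>

locale basis_coordinates = vectorspace class_ring V
  for V :: "('f::field, 'v) module" +
  fixes d :: nat and v :: "nat \<Rightarrow> 'v" and c :: "nat \<Rightarrow> 'v \<Rightarrow> 'f"
  assumes v_closed: "i \<le> d \<Longrightarrow> v i \<in> carrier V"
    and expand: "z \<in> carrier V \<Longrightarrow> (\<Oplus>\<^bsub>V\<^esub>i\<in>{0..d}. c i z \<odot>\<^bsub>V\<^esub> v i) = z"
    and coord_comb: "i \<le> d \<Longrightarrow> c i (\<Oplus>\<^bsub>V\<^esub>i\<in>{0..d}. f i \<odot>\<^bsub>V\<^esub> v i) = f i"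
begin

abbreviation comb :: "(nat \<Rightarrow> 'f) \<Rightarrow> 'v" where
  "comb f \<equiv> (\<Oplus>\<^bsub>V\<^esub>i\<in>{0..d}. f i \<odot>\<^bsub>V\<^esub> v i)"

lemma smult_v_closed [simp]: "i \<le> d \<Longrightarrow> r \<odot>\<^bsub>V\<^esub> v i \<in> carrier V"
  using v_closed by simp

lemma comb_closed: "comb f \<in> carrier V"
  by (intro finsum_closed) auto

lemma comb_add: "comb f \<oplus>\<^bsub>V\<^esub> comb g = comb (\<lambda>i. f i + g i)"
proof -
  have "comb (\<lambda>i. f i + g i) = (\<Oplus>\<^bsub>V\<^esub>i\<in>{0..d}. f i \<odot>\<^bsub>V\<^esub> v i \<oplus>\<^bsub>V\<^esub> g i \<odot>\<^bsub>V\<^esub> v i)"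
    using v_closed smult_l_distr by (intro finsum_cong') auto
  also have "\<dots> = comb f \<oplus>\<^bsub>V\<^esub> comb g"
    by (intro finsum_addf) auto
  finally show ?thesis ..
qed

lemma comb_smult: "r \<odot>\<^bsub>V\<^esub> comb f = comb (\<lambda>i. r * f i)"
proof -
  have "comb (\<lambda>i. r * f i) = (\<Oplus>\<^bsub>V\<^esub>i\<in>{0..d}. r \<odot>\<^bsub>V\<^esub> (f i \<odot>\<^bsub>V\<^esub> v i))"
    using v_closed smult_assoc1 by (intro finsum_cong') auto
  also have "\<dots> = r \<odot>\<^bsub>V\<^esub> comb f"
    by (intro finsum_smult[symmetric]) auto
  finally show ?thesis ..
qed

lemma coord_add:
  assumes "z \<in> carrier V" "z' \<in> carrier V" "i \<le> d"
  shows "c i (z \<oplus>\<^bsub>V\<^esub> z') = c i z + c i z'"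
  using comb_add[of "\<lambda>i. c i z" "\<lambda>i. c i z'"] coord_comb[of i "\<lambda>i. c i z + c i z'"] assms
  by (simp add: expand)

lemma coord_smult:
  assumes "z \<in> carrier V" "i \<le> d"
  shows "c i (r \<odot>\<^bsub>V\<^esub> z) = r * c i z"
  using comb_smult[of r "\<lambda>i. c i z"] coord_comb[of i "\<lambda>i. r * c i z"] assms
  by (simp add: expand)

text \<open>Stated for a bare function so that it covers both \<open>c i\<close> and
  \<open>c i\<close> composed with a linear map.\<close>

lemma functional_comb:
  fixes \<phi> :: "'v \<Rightarrow> 'f"
  assumes add: "\<And>z z'. z \<in> carrier V \<Longrightarrow> z' \<in> carrier V \<Longrightarrow> \<phi> (z \<oplus>\<^bsub>V\<^esub> z') = \<phi> z + \<phi> z'"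
    and smult: "\<And>r z. z \<in> carrier V \<Longrightarrow> \<phi> (r \<odot>\<^bsub>V\<^esub> z) = r * \<phi> z"
  shows "\<phi> (comb f) = (\<Sum>j\<le>d. \<phi> (v j) * f j)"
proof -
  have "\<phi> \<zero>\<^bsub>V\<^esub> = 0" using smult[of "\<zero>\<^bsub>V\<^esub>" 0] by simp
  have "\<phi> (\<Oplus>\<^bsub>V\<^esub>i\<in>J. f i \<odot>\<^bsub>V\<^esub> v i) = (\<Sum>j\<in>J. \<phi> (v j) * f j)" if "J \<subseteq> {0..d}" for J
    using finite_subset[OF that finite_atLeastAtMost] that
  proof (induction J rule: finite_induct)
    case empty
    show ?case using \<open>\<phi> \<zero>\<^bsub>V\<^esub> = 0\<close> by simp
  next
    case (insert j J)
    have fin: "(\<lambda>i. f i \<odot>\<^bsub>V\<^esub> v i) \<in> J \<rightarrow> carrier V" using insert.prems by auto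
    show ?case
      using insert fin v_closed[of j] finsum_closed[OF fin]
      by (simp add: add smult finsum_insert mult.commute)
  qed
  from this[of "{0..d}"] show ?thesis by (simp add: atLeast0AtMost)
qed

lemma coord_linear_map:
  assumes "linear_map class_ring V V A" "represents d V v X A" "z \<in> carrier V" "i \<le> d"
  shows "c i (A z) = (\<Sum>j\<le>d. X $$ (i, j) * c j z)"
proof -
  interpret A: linear_map class_ring V V A by fact
  have "c i (A z) = c i (A (comb (\<lambda>i. c i z)))" using assms by (simp add: expand)
  also have "\<dots> = (\<Sum>j\<le>d. c i (A (v j)) * c j z)"
    using assms(4) A.T_add A.T_smult
    by (intro functional_comb[of "\<lambda>z. c i (A z)"]) (auto simp: coord_add coord_smult)
  also have "\<dots> = (\<Sum>j\<le>d. X $$ (i, j) * c j z)"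
    using assms(2,4) by (intro sum.cong) (auto simp: represents_def coord_comb)
  finally show ?thesis .
qed

lemma coord_basis: "i \<le> d \<Longrightarrow> j \<le> d \<Longrightarrow> c i (v j) = (if i = j then 1 else 0)"
proof -
  assume ij: "i \<le> d" "j \<le> d"
  have "comb (\<lambda>k. if k = j then 1 else 0) = (\<Oplus>\<^bsub>V\<^esub>k\<in>{0..d}. if j = k then v k else \<zero>\<^bsub>V\<^esub>)"
    using v_closed by (intro finsum_cong') (auto simp: lmult_0[simplified] smult_one[simplified])
  also have "\<dots> = v j"
    using ij v_closed by (intro finsum_singleton) auto
  finally show ?thesis using coord_comb[OF ij(1), of "\<lambda>k. if k = j then 1 else 0"] by simp
qed

end

lemma ordered_basis_coordinates:
  fixes V :: "('f::field, 'v) module"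
  assumes "vectorspace class_ring V" "ordered_basis d V v"
  obtains c where "basis_coordinates V d v c"
proof -
  interpret vectorspace class_ring V by fact
  let ?S = "v ` {0..d}"
  have inj: "inj_on v {0..d}" and basis: "basis ?S" and vc: "?S \<subseteq> carrier V"
    using assms(2) by (auto simp: ordered_basis_def basis_def)
  have comb: "(\<Oplus>\<^bsub>V\<^esub>i\<in>{0..d}. f (v i) \<odot>\<^bsub>V\<^esub> v i) = lincomb f ?S" for f
    using inj vc unfolding lincomb_def by (subst finsum_reindex) auto
  have unique: "\<exists>!a. a \<in> ?S \<rightarrow>\<^sub>E UNIV \<and> lincomb a ?S = z" if "z \<in> carrier V" for z
    using basis_criterion[of ?S] basis vc that by auto
  \<comment> \<open>Coefficient functions are unique only once their values outside the basis are
    fixed, hence the extensional function space.\<close>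
  define co where "co z = (THE a. a \<in> ?S \<rightarrow>\<^sub>E UNIV \<and> lincomb a ?S = z)" for z
  have co: "co z \<in> ?S \<rightarrow>\<^sub>E UNIV" "lincomb (co z) ?S = z" if "z \<in> carrier V" for z
    using theI'[OF unique[OF that]] by (auto simp: co_def)
  have "basis_coordinates V d v (\<lambda>i z. co z (v i))"
  proof (unfold_locales)
    fix i assume "i \<le> d"
    thus "v i \<in> carrier V" using vc by auto
  next
    fix z assume "z \<in> carrier V"
    thus "(\<Oplus>\<^bsub>V\<^esub>i\<in>{0..d}. co z (v i) \<odot>\<^bsub>V\<^esub> v i) = z" by (simp add: comb co)
  next
    fix i and f :: "nat \<Rightarrow> 'f" assume i: "i \<le> d"
    define g where "g = restrict (\<lambda>u. f (the_inv_into {0..d} v u)) ?S"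
    have g: "g (v j) = f j" if "j \<le> d" for j
      using that inj by (simp add: g_def the_inv_into_f_f)
    let ?z = "\<Oplus>\<^bsub>V\<^esub>i\<in>{0..d}. f i \<odot>\<^bsub>V\<^esub> v i"
    have z: "?z \<in> carrier V" using vc by (intro finsum_closed) auto
    have "?z = (\<Oplus>\<^bsub>V\<^esub>i\<in>{0..d}. g (v i) \<odot>\<^bsub>V\<^esub> v i)"
      using vc by (intro finsum_cong') (auto simp: g)
    hence "g \<in> ?S \<rightarrow>\<^sub>E UNIV \<and> lincomb g ?S = ?z"
      by (simp add: comb) (simp add: g_def)
    hence "co ?z = g" using unique[OF z] co[OF z] by blast
    thus "co ?z (v i) = f i" using g i by simp
  qed
  thus thesis by (rule that)
qed

text \<open>Replacing \<open>v i\<close> by \<open>\<kappa> i\<close> times \<open>v i\<close>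
  conjugates the matrices by a diagonal one; the isomorphism takes coordinates in the rescaled
  basis.\<close>

lemma affine_equivalent_module_vecI:
  fixes V :: "('f::field, 'v) module"
  assumes "basis_coordinates V d v c"
    and A: "linear_map class_ring V V A" "represents d V v X A"
    and A': "linear_map class_ring V V A'" "represents d V v X' A'"
    and M: "M \<in> carrier_mat (d + 1) (d + 1)" "M' \<in> carrier_mat (d + 1) (d + 1)"
    and nz: "s \<noteq> 0" "s' \<noteq> 0" "\<And>i. i \<le> d \<Longrightarrow> \<kappa> i \<noteq> 0"
    and conj: "\<And>i j. i \<le> d \<Longrightarrow> j \<le> d \<Longrightarrow>
      (s * X $$ (i, j) + (if i = j then t else 0)) * \<kappa> j = \<kappa> i * M $$ (i, j)"
    and conj': "\<And>i j. i \<le> d \<Longrightarrow> j \<le> d \<Longrightarrow>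
      (s' * X' $$ (i, j) + (if i = j then t' else 0)) * \<kappa> j = \<kappa> i * M' $$ (i, j)"
  shows "affine_equivalent V A A' (module_vec TYPE('f) (d + 1)) ((*\<^sub>v) M) ((*\<^sub>v) M')"
proof -
  interpret basis_coordinates V d v c by fact
  interpret W: vectorspace class_ring "module_vec TYPE('f) (d + 1)" by (rule vec_vs)
  define \<sigma> where "\<sigma> z = vec (d + 1) (\<lambda>i. c i z / \<kappa> i)" for z
  have intertwine: "\<sigma> (affine_map V s t A z) = M *\<^sub>v \<sigma> z"
    if A: "linear_map class_ring V V A" "represents d V v X A"
      and M: "M \<in> carrier_mat (d + 1) (d + 1)"
      and conj: "\<And>i j. i \<le> d \<Longrightarrow> j \<le> d \<Longrightarrow>
        (s * X $$ (i, j) + (if i = j then t else 0)) * \<kappa> j = \<kappa> i * M $$ (i, j)"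
      and z: "z \<in> carrier V" for A X M s t z
  proof (intro eq_vecI)
    interpret A: linear_map class_ring V V A by fact
    fix i assume "i < dim_vec (M *\<^sub>v \<sigma> z)"
    hence i: "i \<le> d" using M by simp
    have "c i (affine_map V s t A z) = s * (\<Sum>j\<le>d. X $$ (i, j) * c j z) + t * c i z"
      using z i A.T_im by (simp add: affine_map_def coord_add coord_smult coord_linear_map[OF A])
    also have "\<dots> = (\<Sum>j\<le>d. (s * X $$ (i, j) + (if i = j then t else 0)) * c j z)"
      using i by (simp add: distrib_right sum.distrib sum_distrib_left mult.assoc
        if_distrib[where f = "\<lambda>r. r * _"] cong: if_cong)
    also have "\<dots> = (\<Sum>j\<le>d. \<kappa> i * (M $$ (i, j) * (c j z / \<kappa> j)))"
    proof (intro sum.cong refl)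
      fix j assume "j \<in> {..d}"
      hence j: "j \<le> d" by simp
      have "(s * X $$ (i, j) + (if i = j then t else 0)) * c j z =
          ((s * X $$ (i, j) + (if i = j then t else 0)) * \<kappa> j) * (c j z / \<kappa> j)"
        using nz(3)[OF j] by simp
      thus "(s * X $$ (i, j) + (if i = j then t else 0)) * c j z =
          \<kappa> i * (M $$ (i, j) * (c j z / \<kappa> j))"
        by (simp add: conj[OF i j])
    qed
    finally have "c i (affine_map V s t A z) / \<kappa> i = (\<Sum>j\<le>d. M $$ (i, j) * (c j z / \<kappa> j))"
      using nz(3)[OF i] by (simp add: sum_distrib_left[symmetric] del: times_divide_eq_right)
    thus "\<sigma> (affine_map V s t A z) $ i = (M *\<^sub>v \<sigma> z) $ i"
      using i M by (simp add: \<sigma>_def scalar_prod_def atLeast0LessThan lessThan_Suc_atMost)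
  qed (use M in \<open>simp add: \<sigma>_def\<close>)
  have "linear_map class_ring V (module_vec TYPE('f) (d + 1)) \<sigma>"
  proof (intro linear_map.intro mod_hom.intro mod_hom_axioms.intro)
    show "\<sigma> \<in> LinearCombinations.module_hom class_ring V (module_vec TYPE('f) (d + 1))"
      unfolding LinearCombinations.module_hom_def
      by (auto simp: module_vec_simps \<sigma>_def coord_add coord_smult add_divide_distrib)
  qed (rule vectorspace_axioms W.vectorspace_axioms module_axioms W.module_axioms)+
  moreover have "bij_betw \<sigma> (carrier V) (carrier (module_vec TYPE('f) (d + 1)))"
  proof (rule bij_betw_byWitness[where f' = "\<lambda>z. comb (\<lambda>i. \<kappa> i * z $ i)"])
    show "\<forall>z\<in>carrier V. comb (\<lambda>i. \<kappa> i * \<sigma> z $ i) = z"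
    proof
      fix z assume z: "z \<in> carrier V"
      have "comb (\<lambda>i. \<kappa> i * \<sigma> z $ i) = comb (\<lambda>i. c i z)"
        using nz(3) by (intro finsum_cong') (auto simp: \<sigma>_def)
      thus "comb (\<lambda>i. \<kappa> i * \<sigma> z $ i) = z" using expand[OF z] by simp
    qed
  qed (use nz(3) comb_closed in \<open>auto simp: \<sigma>_def module_vec_simps coord_comb intro!: eq_vecI\<close>)
  ultimately have "isomorphic_pairs V (affine_map V s t A) (affine_map V s' t' A')
      (module_vec TYPE('f) (d + 1)) ((*\<^sub>v) M) ((*\<^sub>v) M')"
    unfolding isomorphic_pairs_def using intertwine[OF A M(1) conj] intertwine[OF A' M(2) conj']
    by blast
  thus ?thesis using nz unfolding affine_equivalent_def by blast
qed

section \<open>Transition matrices and circular bidiagonal sums\<close>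

text \<open>Both sides compute \<open>c i (A (w j))\<close>. In matrix form this is
  \<open>X P = P Y\<close> for the transition matrix \<open>P\<close>.\<close>

lemma basis_change_represents:
  assumes "basis_coordinates V d v c" "basis_coordinates V d w e" "linear_map class_ring V V A"
    and "represents d V v X A" "represents d V w Y A" "i \<le> d" "j \<le> d"
  shows "(\<Sum>k\<le>d. X $$ (i, k) * c k (w j)) = (\<Sum>k\<le>d. c i (w k) * Y $$ (k, j))"
proof -
  interpret v: basis_coordinates V d v c by fact
  interpret w: basis_coordinates V d w e by fact
  have "(\<Sum>k\<le>d. X $$ (i, k) * c k (w j)) = c i (A (w j))"
    using assms w.v_closed by (simp add: v.coord_linear_map)
  also have "\<dots> = (\<Sum>k\<le>d. c i (w k) * Y $$ (k, j))"
    using assms w.functional_comb[of "c i"]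
    by (simp add: represents_def v.coord_add v.coord_smult)
  finally show ?thesis .
qed

lemma basis_change_inverse:
  assumes "basis_coordinates V d v c" "basis_coordinates V d w e" "i \<le> d" "j \<le> d"
  shows "(\<Sum>k\<le>d. c i (w k) * e k (v j)) = (if i = j then 1 else 0)"
proof -
  interpret v: basis_coordinates V d v c by fact
  interpret w: basis_coordinates V d w e by fact
  have "(\<Sum>k\<le>d. c i (w k) * e k (v j)) = c i (w.comb (\<lambda>k. e k (v j)))"
    using assms w.functional_comb[of "c i"] by (simp add: v.coord_add v.coord_smult)
  thus ?thesis using assms v.v_closed by (simp add: w.expand v.coord_basis)
qed

lemma sum_two_terms:
  fixes g :: "nat \<Rightarrow> 'a::comm_monoid_add"
  assumes "p \<le> d" "q \<le> d" "p \<noteq> q" "\<And>k. k \<le> d \<Longrightarrow> k \<noteq> p \<Longrightarrow> k \<noteq> q \<Longrightarrow> g k = 0"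
  shows "(\<Sum>k\<le>d. g k) = g p + g q"
proof -
  have "(\<Sum>k\<le>d. g k) = (\<Sum>k\<in>{p, q}. g k)"
    using assms by (intro sum.mono_neutral_right) auto
  thus ?thesis using assms by simp
qed

text \<open>Modulo \<open>Suc d\<close> the subdiagonal and the corner form one family of positions
  \<open>(j + 1, j)\<close>, so a column has only two possibly nonzero entries;
  \<open>d \<ge> 1\<close> keeps them apart.\<close>

lemma circular_bidiagonal_col_sum:
  assumes "d \<ge> 1" "circular_bidiagonal_mat d Y"
  shows "(\<Sum>k\<le>d. g k * Y $$ (k, j mod Suc d)) =
    g (j mod Suc d) * Y $$ (j mod Suc d, j mod Suc d) +
    g (Suc j mod Suc d) * Y $$ (Suc j mod Suc d, j mod Suc d)"
proof (rule sum_two_terms)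
  fix k assume k: "k \<le> d" "k \<noteq> j mod Suc d" "k \<noteq> Suc j mod Suc d"
  have j: "j mod Suc d \<le> d" by (rule mod_Suc_le_divisor)
  show "g k * Y $$ (k, j mod Suc d) = 0"
  proof -
    have "\<not> (k = j mod Suc d \<or> k = j mod Suc d + 1 \<or> (k = 0 \<and> j mod Suc d = d))"
      using k by (auto simp: mod_Suc split: if_splits)
    thus ?thesis
      using assms(2) k(1) j unfolding circular_bidiagonal_mat_def by (metis mult_zero_right)
  qed
qed (use assms Suc_mod_neq[of "Suc d" j] in auto)

lemma circular_bidiagonal_row_sum:
  assumes "d \<ge> 1" "circular_bidiagonal_mat d X"
  shows "(\<Sum>k\<le>d. X $$ (Suc i mod Suc d, k) * g k) =
    X $$ (Suc i mod Suc d, Suc i mod Suc d) * g (Suc i mod Suc d) +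
    X $$ (Suc i mod Suc d, i mod Suc d) * g (i mod Suc d)"
proof (rule sum_two_terms)
  fix k assume k: "k \<le> d" "k \<noteq> Suc i mod Suc d" "k \<noteq> i mod Suc d"
  have i: "i mod Suc d \<le> d" "Suc i mod Suc d \<le> d" by (rule mod_Suc_le_divisor)+
  have "\<not> (Suc i mod Suc d = k \<or> Suc i mod Suc d = k + 1 \<or> (Suc i mod Suc d = 0 \<and> k = d))"
    using k by (auto simp: mod_Suc split: if_splits)
  thus "X $$ (Suc i mod Suc d, k) * g k = 0"
    using assms(2) k(1) i(2) unfolding circular_bidiagonal_mat_def by (metis mult_zero_left)
qed (use assms Suc_mod_neq[of "Suc d" i] in auto)

lemma circular_bidiagonal_step_nonzero:
  assumes "circular_bidiagonal_mat d X"
  shows "X $$ (Suc i mod Suc d, i mod Suc d) \<noteq> 0"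
proof (cases "i mod Suc d = d")
  case True
  thus ?thesis using assms by (simp add: circular_bidiagonal_mat_def mod_Suc)
next
  case False
  hence "Suc (i mod Suc d) \<in> {1..d}" by (simp add: Suc_le_eq le_neq_implies_less mod_Suc_le_divisor)
  hence "X $$ (Suc (i mod Suc d), Suc (i mod Suc d) - 1) \<noteq> 0"
    using assms unfolding circular_bidiagonal_mat_def by blast
  thus ?thesis using False by (simp add: mod_Suc)
qed

lemma sum_single_term:
  fixes g :: "nat \<Rightarrow> 'a::comm_monoid_add"
  assumes "p \<le> d" "\<And>k. k \<le> d \<Longrightarrow> k \<noteq> p \<Longrightarrow> g k = 0"
  shows "(\<Sum>k\<le>d. g k) = g p"
proof -
  have "(\<Sum>k\<le>d. g k) = (\<Sum>k\<in>{p}. g k)"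
    using assms by (intro sum.mono_neutral_right) auto
  thus ?thesis by simp
qed

text \<open>Both model matrices have this shape, with \<open>\<tau> = 1\<close> and \<open>\<tau> = 0\<close> respectively.\<close>

definition model_mat :: "nat \<Rightarrow> (nat \<Rightarrow> 'f::field) \<Rightarrow> 'f \<Rightarrow> 'f mat" where
  "model_mat d \<alpha> \<tau> = mat (d + 1) (d + 1) (\<lambda>(i, j).
     if i = j then \<alpha> i
     else if i = 0 \<and> j = d then \<tau> - \<alpha> 0
     else if i = j + 1 then \<tau> - \<alpha> i
     else 0)"

text \<open>The second conclusion hides both bases: once the sequences are normalised by affine
  changes, equivalence with the model matrices follows.\<close>

lemma circular_bidiagonal_pair_intertwiner:
  fixes V :: "('f::field, 'v) module"
  assumes d: "d \<ge> 1" and "circular_bidiagonal_pair d V A A'"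
  obtains ts th a b x y P where "bidiagonal_intertwiner (Suc d) ts th a b x y P"
    "\<And>u w u' w' \<alpha> \<tau> \<beta>. u \<noteq> 0 \<Longrightarrow> u' \<noteq> 0 \<Longrightarrow> (\<And>i. u * a i + w = \<alpha> i) \<Longrightarrow> u * th 0 + w = \<tau> \<Longrightarrow>
      (\<And>i. u' * ts i + w' = \<beta> i) \<Longrightarrow>
      affine_equivalent V A A' (module_vec TYPE('f) (d + 1))
        ((*\<^sub>v) (model_mat d \<alpha> \<tau>)) ((*\<^sub>v) (mat_diag (d + 1) \<beta>))"
proof -
  from assms(2) obtain v X D w Y E where
    vs: "vectorspace class_ring V" and
    A: "linear_map class_ring V V A" and A': "linear_map class_ring V V A'" and
    v: "ordered_basis d V v" and vX: "represents d V v X A" and X: "circular_bidiagonal_mat d X"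
      and vD: "represents d V v D A'" and D: "diagonal_mat D" and
    w: "ordered_basis d V w" and wY: "represents d V w Y A'" and Y: "circular_bidiagonal_mat d Y"
      and wE: "represents d V w E A" and E: "diagonal_mat E"
    unfolding circular_bidiagonal_pair_def by blast
  obtain c where c: "basis_coordinates V d v c" using ordered_basis_coordinates[OF vs v] .
  obtain e where e: "basis_coordinates V d w e" using ordered_basis_coordinates[OF vs w] .
  let ?n = "Suc d"
  define P where "P i j = c (i mod ?n) (w (j mod ?n))" for i j
  define ts where "ts i = D $$ (i mod ?n, i mod ?n)" for i
  define th where "th j = E $$ (j mod ?n, j mod ?n)" for j
  define a where "a i = X $$ (i mod ?n, i mod ?n)" for i
  define b where "b j = Y $$ (j mod ?n, j mod ?n)" for j
  define x where "x i = X $$ (Suc i mod ?n, i mod ?n)" for i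
  define y where "y j = Y $$ (Suc j mod ?n, j mod ?n)" for j
  have le: "k mod ?n \<le> d" for k by (rule mod_Suc_le_divisor)
  have D0: "D $$ (i, j) = 0" if "i \<le> d" "j \<le> d" "i \<noteq> j" for i j
    using that D vD by (auto simp: diagonal_mat_def represents_def)
  have E0: "E $$ (i, j) = 0" if "i \<le> d" "j \<le> d" "i \<noteq> j" for i j
    using that E wE by (auto simp: diagonal_mat_def represents_def)
  have "bidiagonal_intertwiner ?n ts th a b x y P"
  proof
    show "2 \<le> ?n" using d by simp
    show "x i \<noteq> 0" for i
      unfolding x_def by (rule circular_bidiagonal_step_nonzero[OF X])
    show "y j \<noteq> 0" for j
      unfolding y_def by (rule circular_bidiagonal_step_nonzero[OF Y])
    show "(ts i - b j) * P i j = y j * P i (Suc j)" for i j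
    proof -
      have "(\<Sum>k\<le>d. D $$ (i mod ?n, k) * c k (w (j mod ?n))) = ts i * P i j"
        unfolding ts_def P_def using le D0 by (intro sum_single_term) auto
      moreover have "(\<Sum>k\<le>d. c (i mod ?n) (w k) * Y $$ (k, j mod ?n)) =
          P i j * b j + P i (Suc j) * y j"
        unfolding b_def y_def P_def by (rule circular_bidiagonal_col_sum[OF d Y])
      ultimately have "ts i * P i j = P i j * b j + P i (Suc j) * y j"
        using basis_change_represents[OF c e A' vD wY le le, of i j] by simp
      thus ?thesis by (simp add: algebra_simps)
    qed
    show "(th j - a (Suc i)) * P (Suc i) j = x i * P i j" for i j
    proof -
      have "(\<Sum>k\<le>d. c (Suc i mod ?n) (w k) * E $$ (k, j mod ?n)) = P (Suc i) j * th j"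
        unfolding th_def P_def using le E0 by (intro sum_single_term) auto
      moreover have "(\<Sum>k\<le>d. X $$ (Suc i mod ?n, k) * c k (w (j mod ?n))) =
          a (Suc i) * P (Suc i) j + x i * P i j"
        unfolding a_def x_def P_def by (rule circular_bidiagonal_row_sum[OF d X])
      ultimately have "a (Suc i) * P (Suc i) j + x i * P i j = P (Suc i) j * th j"
        using basis_change_represents[OF c e A vX wE le le, of "Suc i" j] by simp
      thus ?thesis by (simp add: algebra_simps)
    qed
    \<comment> \<open>Pairing proportional rows with column \<open>i\<close> of the inverse matrix
      would give \<open>1 = l * 0\<close>.\<close>
    show "i mod ?n = k mod ?n" if "\<And>j. P i j = l * P k j" for i k l
    proof (rule ccontr)
      assume neq: "i mod ?n \<noteq> k mod ?n"
      have scaled: "c (i mod ?n) (w m) = l * c (k mod ?n) (w m)" if "m \<le> d" for m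
        using \<open>P i m = l * P k m\<close> that by (simp add: P_def)
      have "(\<Sum>m\<le>d. c (i mod ?n) (w m) * e m (v (i mod ?n))) =
          l * (\<Sum>m\<le>d. c (k mod ?n) (w m) * e m (v (i mod ?n)))"
        by (simp add: scaled sum_distrib_left mult.assoc)
      thus False using neq by (simp add: basis_change_inverse[OF c e] le)
    qed
    show "j mod ?n = k mod ?n" if "\<And>i. P i j = l * P i k" for j k l
    proof (rule ccontr)
      assume neq: "j mod ?n \<noteq> k mod ?n"
      have scaled: "c m (w (j mod ?n)) = l * c m (w (k mod ?n))" if "m \<le> d" for m
        using \<open>P m j = l * P m k\<close> that by (simp add: P_def)
      have "(\<Sum>m\<le>d. e (j mod ?n) (v m) * c m (w (j mod ?n))) =
          l * (\<Sum>m\<le>d. e (j mod ?n) (v m) * c m (w (k mod ?n)))"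
        by (simp add: scaled sum_distrib_left mult.left_commute)
      thus False using neq by (simp add: basis_change_inverse[OF e c] le)
    qed
  qed (simp_all add: P_def ts_def th_def a_def)
  then interpret bidiagonal_intertwiner ?n ts th a b x y P .
  show thesis
  proof (rule that)
    show "bidiagonal_intertwiner ?n ts th a b x y P" ..
    fix u w u' w' :: 'f and \<alpha> \<beta> :: "nat \<Rightarrow> 'f" and \<tau> :: 'f
    assume u: "u \<noteq> 0" "u' \<noteq> 0" and \<alpha>: "\<And>i. u * a i + w = \<alpha> i" and \<tau>: "u * th 0 + w = \<tau>"
      and \<beta>: "\<And>i. u' * ts i + w' = \<beta> i"
    show "affine_equivalent V A A' (module_vec TYPE('f) (d + 1))
        ((*\<^sub>v) (model_mat d \<alpha> \<tau>)) ((*\<^sub>v) (mat_diag (d + 1) \<beta>))"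
    \<comment> \<open>With this scaling the rescaled basis vectors sum to \<open>w 0\<close>, an
      eigenvector of \<open>A\<close>. The all-ones vector thus becomes an eigenvector, which is why
      every row of \<open>model_mat\<close> sums to \<open>\<tau>\<close>.\<close>
    proof (rule affine_equivalent_module_vecI[OF c A vX A' vD,
        where \<kappa> = "\<lambda>i. P i 0" and s = u and t = w and s' = u' and t' = w'])
      show "P i 0 \<noteq> 0" for i by (rule P_nz)
      fix i j assume i: "i \<le> d" and j: "j \<le> d"
      have step: "u * x k * P k 0 = P (Suc k) 0 * (\<tau> - \<alpha> (Suc k))" for k
      proof -
        have "u * x k * P k 0 = u * ((th 0 - a (Suc k)) * P (Suc k) 0)"
          by (simp only: col_step mult.assoc)
        also have "\<dots> = P (Suc k) 0 * (\<tau> - \<alpha> (Suc k))"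
          unfolding \<alpha>[symmetric] \<tau>[symmetric] by (simp add: algebra_simps)
        finally show ?thesis .
      qed
      show "(u * X $$ (i, j) + (if i = j then w else 0)) * P j 0 = P i 0 * model_mat d \<alpha> \<tau> $$ (i, j)"
      proof -
        consider "i = j" | "i = Suc j" | "i = 0" "j = d" | "i \<noteq> j" "i \<noteq> j + 1" "\<not> (i = 0 \<and> j = d)"
          by auto
        thus ?thesis
        proof cases
          case 1
          thus ?thesis using i \<alpha>[of i] by (simp add: model_mat_def a_def)
        next
          case 2
          thus ?thesis using i j d step[of j] by (simp add: model_mat_def x_def)
        next
          case 3
          \<comment> \<open>The corner entry is the step from \<open>d\<close> to
            \<open>Suc d\<close>, which wraps around to 0.\<close>
          have "P (Suc d) 0 = P 0 0" "\<alpha> (Suc d) = \<alpha> 0"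
            by (simp add: P_def) (simp add: \<alpha>[symmetric] a_def)
          thus ?thesis using 3 d step[of d] by (simp add: model_mat_def x_def)
        next
          case 4
          hence "X $$ (i, j) = 0" using X i j unfolding circular_bidiagonal_mat_def by blast
          thus ?thesis using 4 i j by (auto simp: model_mat_def)
        qed
      qed
      show "(u' * D $$ (i, j) + (if i = j then w' else 0)) * P j 0 =
          P i 0 * mat_diag (d + 1) \<beta> $$ (i, j)"
        using i j D0[of i j] \<beta>[of i] by (auto simp: mat_diag_def ts_def)
    qed (use u in \<open>simp_all add: model_mat_def\<close>)
  qed
qed

theorem theorem2p18:
  fixes V :: "('f::field, 'v) module" and A A' :: "'v \<Rightarrow> 'v" and d :: nat
  assumes "d \<ge> 1"
    and "circular_bidiagonal_pair d V A A'"
  shows "(CHAR('f) \<noteq> d + 1 \<longrightarrow>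
           (\<exists>q \<epsilon> :: 'f. primitive_root_of_unity (d + 1) q \<and>
              \<epsilon> \<notin> (\<lambda>i. q ^ i) ` {0..d} \<and>
              affine_equivalent V A A' (module_vec TYPE('f) (d + 1))
                ((*\<^sub>v) (CBP_q_mat d q \<epsilon>)) ((*\<^sub>v) (CBP_q_dual_mat d q)))) \<and>
         (CHAR('f) = d + 1 \<longrightarrow>
           (\<exists>\<gamma> :: 'f. \<gamma> \<notin> of_nat ` {0..d} \<and>
              affine_equivalent V A A' (module_vec TYPE('f) (d + 1))
                ((*\<^sub>v) (CBP_char_mat d \<gamma>)) ((*\<^sub>v) (CBP_char_dual_mat d))))"
proof -
  obtain ts th a b x y P where intertwiner: "bidiagonal_intertwiner (Suc d) ts th a b x y P"
    and equiv: "\<And>u w u' w' \<alpha> \<tau> \<beta>. u \<noteq> 0 \<Longrightarrow> u' \<noteq> 0 \<Longrightarrow> (\<And>i. u * a i + w = \<alpha> i) \<Longrightarrow>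
      u * th 0 + w = \<tau> \<Longrightarrow> (\<And>i. u' * ts i + w' = \<beta> i) \<Longrightarrow>
      affine_equivalent V A A' (module_vec TYPE('f) (d + 1))
        ((*\<^sub>v) (model_mat d \<alpha> \<tau>)) ((*\<^sub>v) (mat_diag (d + 1) \<beta>))"
    using circular_bidiagonal_pair_intertwiner[OF assms] by blast
  interpret bidiagonal_intertwiner "Suc d" ts th a b x y P by (rule intertwiner)
  have range: "{..<Suc d} = {0..d}" by auto
  obtain s r t where s: "s \<noteq> 0" and rec: "\<And>i. ts i = s * ts (Suc i) + r"
    "\<And>j. th (Suc j) = s * th j + t" "\<And>i. a (Suc i) = s * a i + t"
    by (rule affine_recurrence) (rule that)
  show ?thesis
  \<comment> \<open>The split is on \<open>s\<close>, not on the characteristic: each case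
    determines whether the characteristic is \<open>d + 1\<close>, making the other implication
    vacuous.\<close>
  proof (cases "s = 1")
    case True
    obtain u w u' w' \<gamma> where char: "CHAR('f) = Suc d" and u: "u \<noteq> 0" "u' \<noteq> 0"
      and \<gamma>: "\<gamma> \<notin> of_nat ` {..<Suc d}"
      and norm: "\<And>i. u * a i + w = of_nat i + \<gamma>" "u * th 0 + w = 0" "\<And>i. u' * ts i + w' = of_nat i"
      by (rule CHAR_case[OF rec[unfolded True mult_1]]) (rule that)
    have "CBP_char_mat d \<gamma> = model_mat d (\<lambda>i. of_nat i + \<gamma>) 0"
      unfolding CBP_char_mat_def model_mat_def by (intro cong_mat) auto
    with equiv[OF u norm] char \<gamma> show ?thesis
      by (auto simp: CBP_char_dual_mat_def range)
  next
    case False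
    obtain u w u' w' q \<epsilon> where char: "CHAR('f) \<noteq> Suc d" and u: "u \<noteq> 0" "u' \<noteq> 0"
      and q: "primitive_root_of_unity (Suc d) q" and \<epsilon>: "\<epsilon> \<notin> (\<lambda>i. q ^ i) ` {..<Suc d}"
      and norm: "\<And>i. u * a i + w = inverse (q ^ i) * \<epsilon>" "u * th 0 + w = 1"
        "\<And>i. u' * ts i + w' = q ^ i"
      by (rule root_of_unity_case[OF s False rec]) (rule that)
    have mat: "CBP_q_mat d q \<epsilon> = model_mat d (\<lambda>i. inverse (q ^ i) * \<epsilon>) 1"
      unfolding CBP_q_mat_def model_mat_def by (intro cong_mat) auto
    have "affine_equivalent V A A' (module_vec TYPE('f) (d + 1))
        ((*\<^sub>v) (CBP_q_mat d q \<epsilon>)) ((*\<^sub>v) (CBP_q_dual_mat d q))"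
      using equiv[OF u norm] unfolding mat CBP_q_dual_mat_def .
    moreover have "\<epsilon> \<notin> (\<lambda>i. q ^ i) ` {0..d}" using \<epsilon> unfolding range .
    ultimately show ?thesis using char q unfolding Suc_eq_plus1 by blast
  qed
qed

end
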